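(* Let $A$ and $B$ be non-trivial abelian groups, let $I$ be a set with $|I|>1$, let $\varphi_1:A\to B$ be a function with $\varphi_1(-a)=\varphi_1(a)$ for every $a\in A$ and $\varphi_1^{-1}(0)=\{0\}$, and let $\varphi_2:B\to A$ be an injective homomorphism. Let $X(A,B,I)$ be the (irretractable) left cycle set on $A\times B\times I$ with operation $$(a,b,i)\cdot(c,d,j):=\begin{cases}(c,\,d-\varphi_1(a-c),\,j) & \text{if } i=j,\\ (c-\varphi_2(b),\,d,\,j) & \text{if } i\neq j.\end{cases}$$ For $m\in \mathrm{Sym}(I)$ let $\psi_m\in \mathrm{Aut}(X(A,B,I))$ be given by $\psi_m(a,b,i):=(a,b,m(i))$, and let $G:=\{\psi_m : m\in \mathrm{Sym}(I)\}$. Let $(Y,\cdot)$ be a left cycle set whose underlying set is disjoint from $X(A,B,I)$, and let $\alpha:Y\to \mathrm{Aut}(X(A,B,I))$ be an injective function such that $\alpha(Y)\subseteq G$ and $$\alpha(a\cdot b)\,\alpha(a)=\alpha(b\cdot a)\,\alpha(b)\quad\text{for all } a,b\in Y.$$ Let $\circ$ be the operation on $X(A,B,I)\cup Y$ given by $$x\circ y:=\begin{cases}x\cdot y & \text{if } x,y\in X(A,B,I) \text{ or } x,y\in Y,\\ y & \text{if } x\in X(A,B,I),\ y\in Y,\\ \alpha(x)(y) & \text{if } x\in Y,\ y\in X(A,B,I).\end{cases}$$ Then $(X(A,B,I)\cup Y,\circ)$ is an irretractable left cycle set.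
   Context: A left cycle set is a non-empty set $X$ with a binary operation $\cdot$ such that every left multiplication $\sigma_x:X\to X$, $y\mapsto x\cdot y$, is bijective and $(x\cdot y)\cdot(x\cdot z)=(y\cdot x)\cdot(y\cdot z)$ for all $x,y,z\in X$. It is non-degenerate if the squaring map $x\mapsto x\cdot x$ is bijective; by convention, "left cycle set" always means non-degenerate left cycle set. The retraction of $X$ is the set $\sigma(X)=\{\sigma_x : x\in X\}\subseteq \mathrm{Sym}(X)$ with the (well-defined) operation $\sigma_x\cdot\sigma_y:=\sigma_{x\cdot y}$. $X$ is irretractable if $\sigma(X)$ is isomorphic to $X$. An automorphism of $X$ is a bijection $f:X\to X$ with $f(x\cdot y)=f(x)\cdot f(y)$ for all $x,y\in X$; $\mathrm{Aut}(X)$ is the group of automorphisms under composition. *)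

theory Defs
  imports Main "HOL-Algebra.Bij"
begin

text \<open>
  Cycle sets are given by a carrier \<open>X\<close> and an operation \<open>f\<close> that is only
  constrained on \<open>X\<close>.  Permutations of \<open>X\<close> are the elements of \<^const>\<open>Bij\<close> \<open>X\<close>
  from HOL-Algebra, i.e. bijections of \<open>X\<close> that are extensional on \<open>X\<close>; hence equality
  of functions in HOL is equality of permutations of \<open>X\<close>, and composition is
  \<^const>\<open>compose\<close> \<open>X\<close>.
\<close>

locale left_cycle_set =
  fixes X :: "'x set" and f :: "'x \<Rightarrow> 'x \<Rightarrow> 'x"
  assumes nonempty: "X \<noteq> {}"
    and left_mult_bij: "x \<in> X \<Longrightarrow> bij_betw (f x) X X"
    and cycle: "\<lbrakk>x \<in> X; y \<in> X; z \<in> X\<rbrakk> \<Longrightarrow> f (f x y) (f x z) = f (f y x) (f y z)"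
    and non_degenerate: "bij_betw (\<lambda>x. f x x) X X"

definition left_mult :: "'x set \<Rightarrow> ('x \<Rightarrow> 'x \<Rightarrow> 'x) \<Rightarrow> 'x \<Rightarrow> 'x \<Rightarrow> 'x" where
  "left_mult X f x = (\<lambda>y\<in>X. f x y)"

definition retraction :: "'x set \<Rightarrow> ('x \<Rightarrow> 'x \<Rightarrow> 'x) \<Rightarrow> ('x \<Rightarrow> 'x) set" where
  "retraction X f = left_mult X f ` X"

text \<open>
  The operation on the retraction is determined by representatives; independence of the
  choice is the lemma \<open>retraction_op_left_mult\<close> below.
\<close>

definition retraction_op ::
  "'x set \<Rightarrow> ('x \<Rightarrow> 'x \<Rightarrow> 'x) \<Rightarrow> ('x \<Rightarrow> 'x) \<Rightarrow> ('x \<Rightarrow> 'x) \<Rightarrow> ('x \<Rightarrow> 'x)" where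
  "retraction_op X f s t =
    (THE r. \<exists>x\<in>X. \<exists>y\<in>X. s = left_mult X f x \<and> t = left_mult X f y \<and> r = left_mult X f (f x y))"

definition isomorphic ::
  "'x set \<Rightarrow> ('x \<Rightarrow> 'x \<Rightarrow> 'x) \<Rightarrow> 'y set \<Rightarrow> ('y \<Rightarrow> 'y \<Rightarrow> 'y) \<Rightarrow> bool" where
  "isomorphic X f Y g \<longleftrightarrow>
    (\<exists>h. bij_betw h X Y \<and> (\<forall>x\<in>X. \<forall>y\<in>X. h (f x y) = g (h x) (h y)))"

definition irretractable :: "'x set \<Rightarrow> ('x \<Rightarrow> 'x \<Rightarrow> 'x) \<Rightarrow> bool" where
  "irretractable X f \<longleftrightarrow> isomorphic (retraction X f) (retraction_op X f) X f"

definition Aut :: "'x set \<Rightarrow> ('x \<Rightarrow> 'x \<Rightarrow> 'x) \<Rightarrow> ('x \<Rightarrow> 'x) set" where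
  "Aut X f = {h \<in> Bij X. \<forall>x\<in>X. \<forall>y\<in>X. h (f x y) = f (h x) (h y)}"

lemma (in left_cycle_set) closed: "\<lbrakk>x \<in> X; y \<in> X\<rbrakk> \<Longrightarrow> f x y \<in> X"
  using left_mult_bij bij_betwE by blast

lemma (in left_cycle_set) left_mult_op_cong:
  assumes X: "x \<in> X" "y \<in> X" "x' \<in> X" "y' \<in> X"
    and eq: "left_mult X f x = left_mult X f x'" "left_mult X f y = left_mult X f y'"
  shows "left_mult X f (f x y) = left_mult X f (f x' y')"
proof -
  have ex: "f x z = f x' z" if "z \<in> X" for z
    using fun_cong[OF eq(1), of z] that by (simp add: left_mult_def)
  have ey: "f y z = f y' z" if "z \<in> X" for z
    using fun_cong[OF eq(2), of z] that by (simp add: left_mult_def)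
  have "f (f x y) w = f (f x y') w" if w: "w \<in> X" for w
  proof -
    obtain z where z: "z \<in> X" "w = f x z"
      using left_mult_bij[OF X(1)] w by (metis bij_betw_imp_surj_on imageE)
    have "f (f x y) (f x z) = f (f y x) (f y z)" using cycle X z by blast
    also have "\<dots> = f (f y' x) (f y' z)" using ey X z by simp
    also have "\<dots> = f (f x y') (f x z)" using cycle X z by metis
    finally show ?thesis using z by simp
  qed
  then show ?thesis using ex X by (auto simp: left_mult_def fun_eq_iff)
qed

lemma (in left_cycle_set) retraction_op_left_mult:
  assumes "x \<in> X" "y \<in> X"
  shows "retraction_op X f (left_mult X f x) (left_mult X f y) = left_mult X f (f x y)"
  unfolding retraction_op_def
  by (rule the_equality) (use assms in \<open>auto intro: left_mult_op_cong\<close>)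

definition ABI_carrier :: "'i set \<Rightarrow> ('a \<times> 'b \<times> 'i) set" where
  "ABI_carrier I = UNIV \<times> UNIV \<times> I"

definition ABI_op ::
  "('a::ab_group_add \<Rightarrow> 'b::ab_group_add) \<Rightarrow> ('b \<Rightarrow> 'a) \<Rightarrow>
    'a \<times> 'b \<times> 'i \<Rightarrow> 'a \<times> 'b \<times> 'i \<Rightarrow> 'a \<times> 'b \<times> 'i" where
  "ABI_op \<phi>1 \<phi>2 = (\<lambda>(a, b, i) (c, d, j).
     if i = j then (c, d - \<phi>1 (a - c), j) else (c - \<phi>2 b, d, j))"

definition index_perm :: "'i set \<Rightarrow> ('i \<Rightarrow> 'i) \<Rightarrow> 'a \<times> 'b \<times> 'i \<Rightarrow> 'a \<times> 'b \<times> 'i" where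
  "index_perm I m = (\<lambda>(a, b, i) \<in> ABI_carrier I. (a, b, m i))"

text \<open>
  The union of two disjoint cycle sets is rendered as the tagged sum \<open>X <+> Y\<close>, with
  \<open>Inl\<close> marking elements of \<open>X\<close> and \<open>Inr\<close> those of \<open>Y\<close>.
\<close>

fun union_op ::
  "('x \<Rightarrow> 'x \<Rightarrow> 'x) \<Rightarrow> ('y \<Rightarrow> 'y \<Rightarrow> 'y) \<Rightarrow> ('y \<Rightarrow> 'x \<Rightarrow> 'x) \<Rightarrow> 'x + 'y \<Rightarrow> 'x + 'y \<Rightarrow> 'x + 'y" where
  "union_op f g \<alpha> (Inl x) (Inl y) = Inl (f x y)"
| "union_op f g \<alpha> (Inr x) (Inr y) = Inr (g x y)"
| "union_op f g \<alpha> (Inl x) (Inr y) = Inr y"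
| "union_op f g \<alpha> (Inr x) (Inl y) = Inl (\<alpha> x y)"

end

theory Submission
  imports Defs
begin

text \<open>
  The cycle law on the union splits according to which summand each argument lies in.
  Elements of \<open>X\<close> act trivially on \<open>Y\<close>, so a triple that mixes the two summands leaves only
  two conditions: each \<open>\<alpha> y\<close> respects the operation of \<open>X\<close>, and
  \<open>\<alpha> (y \<cdot> y') \<alpha> y = \<alpha> (y' \<cdot> y) \<alpha> y'\<close>.  Hence the extension is a left cycle set for any
  left cycle set \<open>X\<close> acted on in this way (\<open>left_cycle_set_union\<close>).

  A left cycle set whose left multiplications are pairwise distinct is isomorphic to its
  retraction via \<open>x \<mapsto> \<sigma>\<^sub>x\<close> (\<open>irretractable_if_inj\<close>).  On the union, injectivity follows by looking
  at the action on the summand \<open>X\<close> only.  There, two elements of \<open>X\<close> are separated because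
  \<open>X\<close> itself has distinct left multiplications, two elements of \<open>Y\<close> because \<open>\<alpha>\<close> is injective, and
  an element of \<open>X\<close> is separated from one of \<open>Y\<close> because \<open>(a, b, i)\<close> changes the second coordinate of
  \<open>(c, d, i)\<close> whenever \<open>c \<noteq> a\<close>, while permutations of the index never do.
  Below, the fibre of \<open>(a, b, i)\<close> is the set of all triples with the same index \<open>i\<close>.
\<close>

lemma (in left_cycle_set) irretractable_if_inj:
  assumes inj: "inj_on (left_mult X f) X"
  shows "irretractable X f"
proof -
  let ?\<sigma> = "left_mult X f"
  let ?h = "the_inv_into X ?\<sigma>"
  have bij: "bij_betw ?h (retraction X f) X"
    unfolding retraction_def
    by (intro bij_betw_the_inv_into inj_on_imp_bij_betw inj)
  have hom: "?h (retraction_op X f (?\<sigma> x) (?\<sigma> y)) = f (?h (?\<sigma> x)) (?h (?\<sigma> y))"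
    if "x \<in> X" "y \<in> X" for x y
    using that by (simp add: retraction_op_left_mult the_inv_into_f_f inj closed)
  show ?thesis
    unfolding irretractable_def isomorphic_def
  proof (intro exI conjI ballI)
    show "bij_betw ?h (retraction X f) X" by (fact bij)
    fix s t
    assume "s \<in> retraction X f" "t \<in> retraction X f"
    then show "?h (retraction_op X f s t) = f (?h s) (?h t)"
      unfolding retraction_def using hom by blast
  qed
qed

lemma bij_betw_map_sum:
  assumes "bij_betw f A A'" "bij_betw g B B'"
  shows "bij_betw (map_sum f g) (A <+> B) (A' <+> B')"
  unfolding bij_betw_def
proof
  show "inj_on (map_sum f g) (A <+> B)"
    using assms by (intro inj_onI, elim PlusE) (auto dest: bij_betw_imp_inj_on inj_onD)
  have "map_sum f g ` (A <+> B) = f ` A <+> g ` B"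
    by (simp add: Plus_def image_Un image_image)
  then show "map_sum f g ` (A <+> B) = A' <+> B'"
    using assms by (simp add: bij_betw_imp_surj_on)
qed

lemma left_cycle_set_union:
  assumes X: "left_cycle_set X f" and Y: "left_cycle_set Y g"
    and Aut: "\<alpha> \<in> Y \<rightarrow> Aut X f"
    and comp: "\<And>a b. \<lbrakk>a \<in> Y; b \<in> Y\<rbrakk> \<Longrightarrow>
      compose X (\<alpha> (g a b)) (\<alpha> a) = compose X (\<alpha> (g b a)) (\<alpha> b)"
  shows "left_cycle_set (X <+> Y) (union_op f g \<alpha>)"
proof -
  interpret X: left_cycle_set X f by (fact X)
  interpret Y: left_cycle_set Y g by (fact Y)
  have bij: "bij_betw (\<alpha> y) X X" and hom: "\<And>x z. x \<in> X \<Longrightarrow> z \<in> X \<Longrightarrow> \<alpha> y (f x z) = f (\<alpha> y x) (\<alpha> y z)"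
    if "y \<in> Y" for y
    using Aut that by (auto simp: Aut_def Bij_def)
  have comp': "\<alpha> (g a b) (\<alpha> a x) = \<alpha> (g b a) (\<alpha> b x)" if "a \<in> Y" "b \<in> Y" "x \<in> X" for a b x
    using fun_cong[OF comp[OF that(1,2)], of x] that(3) by (simp add: compose_def)
  show ?thesis
  proof
    show "X <+> Y \<noteq> {}" using X.nonempty by auto
  next
    fix x assume "x \<in> X <+> Y"
    then show "bij_betw (union_op f g \<alpha> x) (X <+> Y) (X <+> Y)"
    proof
      fix x' assume x': "x = Inl x'" "x' \<in> X"
      then have "union_op f g \<alpha> x = map_sum (f x') id"
        by (auto simp: fun_eq_iff split_sum_all)
      then show ?thesis using X.left_mult_bij[OF x'(2)] by (simp add: bij_betw_map_sum)
    next
      fix y assume y: "x = Inr y" "y \<in> Y"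
      then have "union_op f g \<alpha> x = map_sum (\<alpha> y) (g y)"
        by (auto simp: fun_eq_iff split_sum_all)
      then show ?thesis using bij[OF y(2)] Y.left_mult_bij[OF y(2)] by (simp add: bij_betw_map_sum)
    qed
  next
    fix x y z assume "x \<in> X <+> Y" "y \<in> X <+> Y" "z \<in> X <+> Y"
    then show "union_op f g \<alpha> (union_op f g \<alpha> x y) (union_op f g \<alpha> x z) =
        union_op f g \<alpha> (union_op f g \<alpha> y x) (union_op f g \<alpha> y z)"
      by (elim PlusE) (auto intro: hom hom[symmetric] comp' X.cycle Y.cycle)
  next
    have "(\<lambda>x. union_op f g \<alpha> x x) = map_sum (\<lambda>x. f x x) (\<lambda>y. g y y)"
      by (auto simp: fun_eq_iff split_sum_all)
    then show "bij_betw (\<lambda>x. union_op f g \<alpha> x x) (X <+> Y) (X <+> Y)"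
      using X.non_degenerate Y.non_degenerate by (simp add: bij_betw_map_sum)
  qed
qed

text \<open>
  Two cases carry content.  If \<open>x\<close> and \<open>z\<close> share a fibre and \<open>y\<close> lies in another, then \<open>y\<close> translates
  the first coordinates of \<open>x\<close> and \<open>z\<close> alike, and \<open>x\<close> acts on \<open>z\<close> only through their difference.
  If \<open>x = (a, b, i)\<close> and \<open>y = (c, d, i)\<close> share a fibre and \<open>z\<close> lies in another, then the first
  coordinate of \<open>z\<close> is lowered by \<open>\<phi>2 b + \<phi>2 (d - \<phi>1 (a - c))\<close>, which is symmetric in \<open>x\<close> and \<open>y\<close>
  because \<open>\<phi>2\<close> is additive and \<open>\<phi>1\<close> is even.
\<close>
lemma left_cycle_set_ABI:
  fixes \<phi>1 :: "'a::ab_group_add \<Rightarrow> 'b::ab_group_add"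
    and I :: "'i set"
  assumes nonempty: "I \<noteq> {}"
    and even: "\<And>a. \<phi>1 (- a) = \<phi>1 a"
    and hom: "\<And>b b'. \<phi>2 (b + b') = \<phi>2 b + \<phi>2 b'"
  shows "left_cycle_set (ABI_carrier I) (ABI_op \<phi>1 \<phi>2)"
proof
  show "(ABI_carrier I :: ('a \<times> 'b \<times> 'i) set) \<noteq> {}"
    using nonempty by (auto simp: ABI_carrier_def)
next
  fix x :: "'a \<times> 'b \<times> 'i"
  obtain a b i where x: "x = (a, b, i)" by (cases x) auto
  let ?inv = "\<lambda>(c, d, j). if i = j then (c, d + \<phi>1 (a - c), j) else (c + \<phi>2 b, d, j)"
  show "bij_betw (ABI_op \<phi>1 \<phi>2 x) (ABI_carrier I) (ABI_carrier I)"
    by (rule bij_betw_byWitness[where f' = ?inv])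
      (auto simp: x ABI_op_def ABI_carrier_def split: if_splits)
next
  have sym: "\<phi>1 (a - c) = \<phi>1 (c - a)" for a c
    using even[of "a - c"] by simp
  have diff: "\<phi>2 (b - b') = \<phi>2 b - \<phi>2 b'" for b b'
    using hom[of "b - b'" b'] by (simp add: eq_diff_eq)
  fix x y z :: "'a \<times> 'b \<times> 'i"
  obtain a b i c d j e f k where "x = (a, b, i)" "y = (c, d, j)" "z = (e, f, k)"
    by (metis prod_cases3)
  then show "ABI_op \<phi>1 \<phi>2 (ABI_op \<phi>1 \<phi>2 x y) (ABI_op \<phi>1 \<phi>2 x z) =
      ABI_op \<phi>1 \<phi>2 (ABI_op \<phi>1 \<phi>2 y x) (ABI_op \<phi>1 \<phi>2 y z)"
    by (cases "i = j"; cases "i = k"; cases "j = k")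
      (simp_all add: ABI_op_def diff sym[of c a] diff_right_commute add.commute)
next
  have "(\<lambda>x :: 'a \<times> 'b \<times> 'i. ABI_op \<phi>1 \<phi>2 x x) = (\<lambda>(a, b, i). (a, b - \<phi>1 0, i))"
    by (auto simp: ABI_op_def)
  moreover have "bij_betw (\<lambda>(a, b, i). (a, b - \<phi>1 0, i))
      (ABI_carrier I :: ('a \<times> 'b \<times> 'i) set) (ABI_carrier I)"
    by (rule bij_betw_byWitness[where f' = "\<lambda>(a, b, i). (a, b + \<phi>1 0, i)"])
      (auto simp: ABI_carrier_def)
  ultimately show "bij_betw (\<lambda>x. ABI_op \<phi>1 \<phi>2 x x) (ABI_carrier I) (ABI_carrier I)"
    by (simp only:)
qed

text \<open>
  This tells \<open>(a, b, i)\<close> apart from elements of other fibres and from permutations of the index,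
  all of which fix the second coordinate on the whole fibre over \<open>i\<close>.  It holds since \<open>A\<close> has some
  \<open>c \<noteq> a\<close>, and \<open>\<phi>1\<close> vanishes only at \<open>0\<close>.
\<close>
lemma ABI_op_moves_snd:
  fixes \<phi>1 :: "'a::ab_group_add \<Rightarrow> 'b::ab_group_add"
  assumes "\<exists>a::'a. a \<noteq> 0" and zero: "\<phi>1 -` {0} = {0}"
  obtains c where "fst (snd (ABI_op \<phi>1 \<phi>2 (a, b, i) (c, d, i))) \<noteq> d"
proof -
  obtain a' :: 'a where "a' \<noteq> 0" using assms(1) by blast
  then have "\<phi>1 (a - (a - a')) \<noteq> 0" using zero by auto
  then show thesis by (intro that[of "a - a'"]) (simp add: ABI_op_def)
qed

lemma inj_on_left_mult_ABI:
  fixes \<phi>1 :: "'a::ab_group_add \<Rightarrow> 'b::ab_group_add"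
    and I :: "'i set"
  assumes A: "\<exists>a::'a. a \<noteq> 0"
    and I: "\<exists>i\<in>I. \<exists>j\<in>I. i \<noteq> j"
    and zero: "\<phi>1 -` {0} = {0}"
    and inj: "inj \<phi>2"
  shows "inj_on (left_mult (ABI_carrier I) (ABI_op \<phi>1 \<phi>2)) (ABI_carrier I)"
proof (rule inj_onI)
  fix x x' :: "'a \<times> 'b \<times> 'i"
  assume X: "x \<in> ABI_carrier I" "x' \<in> ABI_carrier I"
    and eq: "left_mult (ABI_carrier I) (ABI_op \<phi>1 \<phi>2) x = left_mult (ABI_carrier I) (ABI_op \<phi>1 \<phi>2) x'"
  obtain a b i a' b' i' where x: "x = (a, b, i)" "x' = (a', b', i')"
    by (metis prod_cases3)
  have i: "i \<in> I" using X x by (auto simp: ABI_carrier_def)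
  have eq': "ABI_op \<phi>1 \<phi>2 (a, b, i) (c, d, j) = ABI_op \<phi>1 \<phi>2 (a', b', i') (c, d, j)" if "j \<in> I" for c d j
    using fun_cong[OF eq, of "(c, d, j)"] that by (simp add: left_mult_def ABI_carrier_def x)
  have ii: "i = i'"
  proof (rule ccontr)
    assume "i \<noteq> i'"
    obtain c where "fst (snd (ABI_op \<phi>1 \<phi>2 (a, b, i) (c, 0, i))) \<noteq> 0"
      using ABI_op_moves_snd[OF A zero] .
    then show False using eq'[OF i, of c 0] \<open>i \<noteq> i'\<close> by (simp add: ABI_op_def)
  qed
  \<comment> \<open>Within its fibre, \<open>(a, b, i)\<close> fixes \<open>(c, d, i)\<close> exactly if \<open>c = a\<close>, so its action reveals \<open>a\<close>.\<close>
  have "\<phi>1 0 = 0" using zero by auto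
  then have "\<phi>1 (a' - a) = 0" using eq'[OF i, of a 0] ii by (simp add: ABI_op_def)
  then have "a' - a \<in> \<phi>1 -` {0}" by simp
  then have aa: "a = a'" using zero by simp
  obtain j where "j \<in> I" "j \<noteq> i" using I by metis
  then have "\<phi>2 b = \<phi>2 b'" using eq'[of j 0 0] ii by (simp add: ABI_op_def)
  then have "b = b'" using inj by (simp add: inj_eq)
  then show "x = x'" using ii aa x by simp
qed

text \<open>
  Elements of the union are separated by their action on the summand \<open>X\<close> alone, where those of
  \<open>X\<close> act by their left multiplications and those of \<open>Y\<close> through \<open>\<alpha>\<close>.
\<close>
lemma inj_on_left_mult_union:
  assumes X: "inj_on (left_mult X f) X"
    and Y: "inj_on \<alpha> Y" and ext: "\<And>y. y \<in> Y \<Longrightarrow> \<alpha> y \<in> extensional X"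
    and XY: "\<And>x y. \<lbrakk>x \<in> X; y \<in> Y\<rbrakk> \<Longrightarrow> left_mult X f x \<noteq> \<alpha> y"
  shows "inj_on (left_mult (X <+> Y) (union_op f g \<alpha>)) (X <+> Y)"
proof -
  define action where "action = case_sum (left_mult X f) \<alpha>"
  have "inj_on action (X <+> Y)"
  proof (rule inj_onI)
    fix u v assume "u \<in> X <+> Y" "v \<in> X <+> Y" "action u = action v"
    then show "u = v"
      by (elim PlusE)
        (auto simp: action_def XY XY[THEN not_sym] inj_on_eq_iff[OF X] inj_on_eq_iff[OF Y])
  qed
  moreover have "action u = action v"
    if uv: "u \<in> X <+> Y" "v \<in> X <+> Y"
      and eq: "left_mult (X <+> Y) (union_op f g \<alpha>) u = left_mult (X <+> Y) (union_op f g \<alpha>) v" for u v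
  proof (rule extensionalityI[of _ X])
    show "action u \<in> extensional X" "action v \<in> extensional X"
      using uv ext by (auto simp: action_def left_mult_def)
    fix z assume z: "z \<in> X"
    have "union_op f g \<alpha> w (Inl z) = Inl (action w z)" for w
      using z by (cases w) (auto simp: action_def left_mult_def)
    then show "action u z = action v z"
      using fun_cong[OF eq, of "Inl z"] z by (simp add: left_mult_def InlI)
  qed
  ultimately show ?thesis unfolding inj_on_def by blast
qed

theorem proposition13:
  fixes \<phi>1 :: "'a::ab_group_add \<Rightarrow> 'b::ab_group_add"
    and \<phi>2 :: "'b \<Rightarrow> 'a"
    and I :: "'i set"
    and Y :: "'y set"
    and dot :: "'y \<Rightarrow> 'y \<Rightarrow> 'y"
    and \<alpha> :: "'y \<Rightarrow> 'a \<times> 'b \<times> 'i \<Rightarrow> 'a \<times> 'b \<times> 'i"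
  defines "X \<equiv> ABI_carrier I :: ('a \<times> 'b \<times> 'i) set"
    and "G \<equiv> index_perm I ` Bij I"
  assumes A_nontrivial: "\<exists>a::'a. a \<noteq> 0"
    and B_nontrivial: "\<exists>b::'b. b \<noteq> 0"
    and I_card: "\<exists>i\<in>I. \<exists>j\<in>I. i \<noteq> j"
    and phi1_even: "\<And>a. \<phi>1 (- a) = \<phi>1 a"
    and phi1_zero: "\<phi>1 -` {0} = {0}"
    and phi2_hom: "\<And>b b'. \<phi>2 (b + b') = \<phi>2 b + \<phi>2 b'"
    and phi2_inj: "inj \<phi>2"
    and Y: "left_cycle_set Y dot"
    and alpha_Aut: "\<alpha> \<in> Y \<rightarrow> Aut X (ABI_op \<phi>1 \<phi>2)"
    and alpha_inj: "inj_on \<alpha> Y"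
    and alpha_G: "\<alpha> ` Y \<subseteq> G"
    and alpha_cycle: "\<And>a b. \<lbrakk>a \<in> Y; b \<in> Y\<rbrakk> \<Longrightarrow>
      compose X (\<alpha> (dot a b)) (\<alpha> a) = compose X (\<alpha> (dot b a)) (\<alpha> b)"
  shows "left_cycle_set (X <+> Y) (union_op (ABI_op \<phi>1 \<phi>2) dot \<alpha>) \<and>
    irretractable (X <+> Y) (union_op (ABI_op \<phi>1 \<phi>2) dot \<alpha>)"
proof
  have X: "left_cycle_set X (ABI_op \<phi>1 \<phi>2)"
    unfolding X_def using I_card by (intro left_cycle_set_ABI phi1_even phi2_hom) auto
  show U: "left_cycle_set (X <+> Y) (union_op (ABI_op \<phi>1 \<phi>2) dot \<alpha>)"
    by (intro left_cycle_set_union X Y alpha_Aut alpha_cycle)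
  have "inj_on (left_mult (X <+> Y) (union_op (ABI_op \<phi>1 \<phi>2) dot \<alpha>)) (X <+> Y)"
  proof (rule inj_on_left_mult_union)
    show "inj_on (left_mult X (ABI_op \<phi>1 \<phi>2)) X"
      unfolding X_def by (intro inj_on_left_mult_ABI A_nontrivial I_card phi1_zero phi2_inj)
    show "inj_on \<alpha> Y" by (fact alpha_inj)
    show "\<alpha> y \<in> extensional X" if "y \<in> Y" for y
      using alpha_Aut that by (auto simp: Aut_def Bij_def)
    show "left_mult X (ABI_op \<phi>1 \<phi>2) x \<noteq> \<alpha> y" if x: "x \<in> X" and y: "y \<in> Y" for x y
    proof
      assume eq: "left_mult X (ABI_op \<phi>1 \<phi>2) x = \<alpha> y"
      obtain a b i where abi: "x = (a, b, i)" "i \<in> I"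
        using x by (auto simp: X_def ABI_carrier_def)
      obtain m where m: "\<alpha> y = index_perm I m" using alpha_G y by (auto simp: G_def)
      obtain c where c: "fst (snd (ABI_op \<phi>1 \<phi>2 (a, b, i) (c, 0, i))) \<noteq> 0"
        using ABI_op_moves_snd[OF A_nontrivial phi1_zero] .
      have "ABI_op \<phi>1 \<phi>2 (a, b, i) (c, 0, i) = (c, 0, m i)"
        using fun_cong[OF eq, of "(c, 0, i)"] abi
        by (simp add: m left_mult_def index_perm_def X_def ABI_carrier_def)
      then show False using c by simp
    qed
  qed
  then show "irretractable (X <+> Y) (union_op (ABI_op \<phi>1 \<phi>2) dot \<alpha>)"
    by (rule left_cycle_set.irretractable_if_inj[OF U])
qed

end
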